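(* Let $G_1$ and $G_2$ be isomorphic graphs. Then their certificates computed by the RSVP procedure are equivalent, $\mathscr{C}(G_1)\equiv\mathscr{C}(G_2)$; that is, the collections (multisets) of vertex signatures $\{\mathbb{S}_{G_1}(v)\}_{v\in V(G_1)}$ and $\{\mathbb{S}_{G_2}(w)\}_{w\in V(G_2)}$ coincide up to ordering.
   Context: Graphs are finite, simple, undirected, unlabeled and unweighted. For a graph $G=(V,E)$, $N(v)$ denotes the set of neighbours of $v$ and $d_G(x,y)$ the hop distance (length of a shortest path). Fixed data (the same for all graphs): an injective map $\mathcal{P}$ from the nonnegative integers to the set of primes $\ge 3$; a real constant $\kappa$ used as a convention below. The RSVP vertex signature. Let $G=(V,E)$ have $n$ vertices. (1) Pairwise distances: compute $d_G(x,y)$ for all $x,y\in V$ by breadth-first search (BFS) from each vertex. (2) Multi-source reachability: for $v\in V$, let $G'=G-v$ ($v$ and its incident edges are deleted). For each start vertex $s\in N(v)$, run a modified BFS on $G'$ from $s$: each vertex is inserted in the queue and visited once, as in ordinary BFS, but when a vertex $u$ is visited, every edge $\{u,x\}$ of $G'$ incident to $u$ is considered (even if $x$ was already discovered or visited), and an entry "$x$ is reached with hop-distance $d_{G'}(s,u)+1$ from $s$ via the immediate parent $u$" is recorded for $x$. (3) Aggregation: merge the entries over all $s\in N(v)$, measuring hops from $v$ (i.e. adding $1$ for the step from $v$ to $s$). Thus, for $t\in V\setminus\{v\}$ and an integer $h\ge 2$, the parent list of $t$ at hop-distance $h$ from $v$ is the set $$pl_h(v\to t)=\{u : \{u,t\}\in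 E(G'),\ \exists s\in N(v)\ \text{with}\ d_{G'}(s,u)+2=h\},$$ and $pl_1(v\to t)=\{v\}$ if $t\in N(v)$, $pl_1(v\to t)=\emptyset$ otherwise. Let $\mathcal{HP}_{v\to t}$ be the collection of all triples $\langle h@c, pl\rangle$ with $pl=pl_h(v\to t)\neq\emptyset$ and $c=|pl|$ (the number of distinct immediate parents). If there is no such $h$ (in particular for $t=v$, or $t$ not reachable from $v$), set $\mathcal{HP}_{v\to t}=\{\langle 0@0,\emptyset\rangle\}$. (4) Signature: for a finite set $pl$ of vertices with at least two elements, $AvPD(pl)$ is the average of $d_G(x,y)$ over all unordered pairs of distinct $x,y\in pl$; if $|pl|\le 1$, $AvPD(pl)=\kappa$. Put $$\mathcal{S}(v\to t)=\prod_{\langle h@c,pl\rangle\in\mathcal{HP}_{v\to t}} AvPD(pl)\cdot \mathcal{P}(h)^{c}.$$ The signature $\mathbb{S}_G(v)$ is the sequence of the $n$ real numbers $\mathcal{S}(v\to t)$, $t\in V$, sorted in nondecreasing order. (5) Certificate: $\mathscr{C}(G)=\{\mathbb{S}_G(v)\}_{v\in V}$, the collection with multiplicity of all vertex signatures. Two certificates are equivalent ($\equiv$) if there is a bijection between the vertices of the two graphs under which corresponding signatures are equal. RSVP reports "isomorphic" exactly when the certificates are equivalent. *)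

theory Defs
  imports Complex_Main "HOL-Library.Extended_Nat" "HOL-Library.Multiset"
    "HOL-Computational_Algebra.Primes"
begin

record 'a graph =
  verts :: "'a set"
  edges :: "'a set set"

definition simple_graph :: "'a graph \<Rightarrow> bool" where
  "simple_graph G \<longleftrightarrow>
     finite (verts G) \<and> (\<forall>e \<in> edges G. e \<subseteq> verts G \<and> card e = 2)"

definition graph_iso :: "('a \<Rightarrow> 'b) \<Rightarrow> 'a graph \<Rightarrow> 'b graph \<Rightarrow> bool" where
  "graph_iso f G H \<longleftrightarrow> bij_betw f (verts G) (verts H) \<and>
     (\<forall>u \<in> verts G. \<forall>v \<in> verts G. {u, v} \<in> edges G \<longleftrightarrow> {f u, f v} \<in> edges H)"

definition isomorphic :: "'a graph \<Rightarrow> 'b graph \<Rightarrow> bool" where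
  "isomorphic G H \<longleftrightarrow> (\<exists>f. graph_iso f G H)"

definition nbhd :: "'a graph \<Rightarrow> 'a \<Rightarrow> 'a set" where
  "nbhd G v = {u \<in> verts G. {v, u} \<in> edges G}"

definition delete_vertex :: "'a graph \<Rightarrow> 'a \<Rightarrow> 'a graph" where
  "delete_vertex G v = \<lparr>verts = verts G - {v}, edges = {e \<in> edges G. v \<notin> e}\<rparr>"

definition is_path :: "'a graph \<Rightarrow> 'a \<Rightarrow> 'a list \<Rightarrow> 'a \<Rightarrow> bool" where
  "is_path G x p y \<longleftrightarrow> p \<noteq> [] \<and> hd p = x \<and> last p = y \<and> distinct p \<and>
     set p \<subseteq> verts G \<and> successively (\<lambda>a b. {a, b} \<in> edges G) p"

text \<open>The distance is \<open>\<infinity>\<close> when no path exists. A path given by its list of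
  vertices has one edge fewer than vertices.\<close>

definition hop_dist :: "'a graph \<Rightarrow> 'a \<Rightarrow> 'a \<Rightarrow> enat" where
  "hop_dist G x y = (INF p \<in> {p. is_path G x p y}. enat (length p - 1))"

lemma is_path_rev: "is_path G x p y \<Longrightarrow> is_path G y (rev p) x"
  by (auto simp: is_path_def hd_rev last_rev insert_commute)

lemma hop_dist_commute: "hop_dist G x y = hop_dist G y x"
proof -
  have le: "hop_dist G a b \<le> hop_dist G b a" for a b
    unfolding hop_dist_def
  proof (rule INF_mono)
    fix p assume "p \<in> {p. is_path G b p a}"
    then show "\<exists>q \<in> {q. is_path G a q b}. enat (length q - 1) \<le> enat (length p - 1)"
      by (intro bexI[of _ "rev p"]) (auto dest: is_path_rev)
  qed
  show ?thesis by (rule antisym[OF le le])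
qed

text \<open>The distance of an unordered pair; well defined since \<^const>\<open>hop_dist\<close> is symmetric.\<close>

definition pair_dist :: "'a graph \<Rightarrow> 'a set \<Rightarrow> enat" where
  "pair_dist G e = (THE d. \<exists>x y. e = {x, y} \<and> d = hop_dist G x y)"

lemma pair_dist_insert [simp]: "pair_dist G {x, y} = hop_dist G x y"
  unfolding pair_dist_def
proof (rule the_equality)
  show "\<exists>x' y'. {x, y} = {x', y'} \<and> hop_dist G x y = hop_dist G x' y'" by blast
next
  fix d assume "\<exists>x' y'. {x, y} = {x', y'} \<and> d = hop_dist G x' y'"
  then show "d = hop_dist G x y" by (auto simp: doubleton_eq_iff hop_dist_commute)
qed

text \<open>In \<open>AvPD\<close> the coercion \<^const>\<open>the_enat\<close> is only ever used at finite distances: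
  \<open>AvPD\<close> is applied to parent lists, all members of which are connected to the source.\<close>

definition AvPD :: "real \<Rightarrow> 'a graph \<Rightarrow> 'a set \<Rightarrow> real" where
  "AvPD \<kappa> G pl =
     (if card pl \<le> 1 then \<kappa>
      else (\<Sum>e \<in> {e. e \<subseteq> pl \<and> card e = 2}. real (the_enat (pair_dist G e)))
             / real (card {e. e \<subseteq> pl \<and> card e = 2}))"

text \<open>For \<open>h \<ge> 2\<close> an element \<open>u\<close> is reached from a neighbour \<open>s\<close> of \<open>v\<close> inside \<open>G - v\<close>;
  the summand 2 counts the step from \<open>v\<close> to \<open>s\<close> and the step from \<open>u\<close> to \<open>t\<close>. The equation
  with \<open>enat h\<close> entails that \<open>u\<close> is reachable from \<open>s\<close>.\<close>

definition parent_list :: "'a graph \<Rightarrow> 'a \<Rightarrow> 'a \<Rightarrow> nat \<Rightarrow> 'a set" where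
  "parent_list G v t h =
     (if h = 0 then {}
      else if h = 1 then (if t \<in> nbhd G v then {v} else {})
      else {u. {u, t} \<in> edges (delete_vertex G v) \<and>
               (\<exists>s \<in> nbhd G v. hop_dist (delete_vertex G v) s u + 2 = enat h)})"

text \<open>A triple \<open>(h, c, pl)\<close> stands for \<open>\<langle>h@c, pl\<rangle>\<close>.\<close>

definition hop_parents :: "'a graph \<Rightarrow> 'a \<Rightarrow> 'a \<Rightarrow> (nat \<times> nat \<times> 'a set) set" where
  "hop_parents G v t =
     (let T = {(h, card (parent_list G v t h), parent_list G v t h) | h.
                 parent_list G v t h \<noteq> {}}
      in if T = {} then {(0, 0, {})} else T)"

lemma finite_hop_parents:
  assumes "simple_graph G"
  shows "finite (hop_parents G v t)"
proof -
  let ?G' = "delete_vertex G v"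
  have fin: "finite (verts G)" using assms by (simp add: simple_graph_def)
  let ?D = "(\<lambda>(s, u). the_enat (hop_dist ?G' s u + 2)) ` (verts G \<times> verts G)"
  have "h \<in> insert 1 ?D" if ne: "parent_list G v t h \<noteq> {}" for h
  proof (cases "h = 1")
    case False
    with ne obtain u s where "{u, t} \<in> edges G" and s: "s \<in> nbhd G v"
      and h: "hop_dist ?G' s u + 2 = enat h"
      by (auto simp: parent_list_def delete_vertex_def split: if_splits)
    then have u: "u \<in> verts G" using assms by (auto simp: simple_graph_def)
    have "(\<lambda>(s, u). the_enat (hop_dist ?G' s u + 2)) (s, u) = h" using h by simp
    moreover have "(s, u) \<in> verts G \<times> verts G" using u s by (simp add: nbhd_def)
    ultimately show ?thesis by (metis imageI insertI2)
  qed simp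
  then have "{h. parent_list G v t h \<noteq> {}} \<subseteq> insert 1 ?D" by blast
  then have "finite {h. parent_list G v t h \<noteq> {}}"
    using fin by (meson finite_SigmaI finite_imageI finite_insert finite_subset)
  then show ?thesis by (simp add: hop_parents_def Let_def)
qed

lemma hop_parents_self:
  assumes "simple_graph G"
  shows "hop_parents G v v = {(0, 0, {})}"
proof -
  have "{v} \<notin> edges G" using assms by (auto simp: simple_graph_def)
  then have "parent_list G v v h = {}" for h
    by (auto simp: parent_list_def nbhd_def delete_vertex_def)
  then show ?thesis by (simp add: hop_parents_def)
qed

definition pair_sig :: "(nat \<Rightarrow> nat) \<Rightarrow> real \<Rightarrow> 'a graph \<Rightarrow> 'a \<Rightarrow> 'a \<Rightarrow> real" where
  "pair_sig P \<kappa> G v t = (\<Prod>(h, c, pl) \<in> hop_parents G v t. AvPD \<kappa> G pl * real (P h) ^ c)"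

definition signature :: "(nat \<Rightarrow> nat) \<Rightarrow> real \<Rightarrow> 'a graph \<Rightarrow> 'a \<Rightarrow> real list" where
  "signature P \<kappa> G v =
     sorted_list_of_multiset (image_mset (pair_sig P \<kappa> G v) (mset_set (verts G)))"

definition certificate :: "(nat \<Rightarrow> nat) \<Rightarrow> real \<Rightarrow> 'a graph \<Rightarrow> real list multiset" where
  "certificate P \<kappa> G = image_mset (signature P \<kappa> G) (mset_set (verts G))"

definition certificates_equivalent ::
  "(nat \<Rightarrow> nat) \<Rightarrow> real \<Rightarrow> 'a graph \<Rightarrow> 'b graph \<Rightarrow> bool" where
  "certificates_equivalent P \<kappa> G H \<longleftrightarrow>
     (\<exists>g. bij_betw g (verts G) (verts H) \<and>
          (\<forall>v \<in> verts G. signature P \<kappa> G v = signature P \<kappa> H (g v)))"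

end

theory Submission imports Defs begin

text \<open>Every ingredient of a signature is defined from adjacency alone, so an isomorphism
  \<open>f\<close> transports it. Paths map to paths of equal length, hence distances agree
  (\<open>hop_dist_iso\<close>). The same \<open>f\<close> is an isomorphism after deleting
  \<open>v\<close> and \<open>f v\<close> (\<open>graph_iso_delete_vertex\<close>), so parent lists
  correspond under \<open>f\<close> hop by hop (\<open>parent_list_iso\<close>), with equal sizes
  and equal average pairwise distances (\<open>AvPD_iso\<close>). The factors of each product then
  match one to one (\<open>pair_sig_iso\<close>). As \<open>f\<close> also permutes the targets
  \<open>t\<close>, the values for \<open>v\<close> and \<open>f v\<close> form the same multiset
  and sort to the same list; \<open>f\<close> itself is the bijection that matches the
  certificates.\<close>

text \<open>This symmetry turns the one-sided bounds below, for distances and for parent lists, into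
  equalities.\<close>

lemma graph_iso_inv_into:
  assumes "graph_iso f G H"
  shows "graph_iso (inv_into (verts G) f) H G"
proof -
  let ?g = "inv_into (verts G) f"
  have bij: "bij_betw f (verts G) (verts H)"
    using assms by (simp add: graph_iso_def)
  have g: "?g x \<in> verts G" "f (?g x) = x" if "x \<in> verts H" for x
    using bij that by (auto simp: bij_betw_def inv_into_into f_inv_into_f)
  have "{u, v} \<in> edges H \<longleftrightarrow> {?g u, ?g v} \<in> edges G" if "u \<in> verts H" "v \<in> verts H" for u v
    using assms g[OF that(1)] g[OF that(2)] by (metis graph_iso_def)
  then show ?thesis
    using bij by (simp add: graph_iso_def bij_betw_inv_into)
qed

lemma is_path_map:
  assumes "graph_iso f G H" and "is_path G x p y"
  shows "is_path H (f x) (map f p) (f y)"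
proof -
  have p: "set p \<subseteq> verts G" and inj: "inj_on f (verts G)" and im: "f ` verts G = verts H"
    using assms by (auto simp: is_path_def graph_iso_def bij_betw_def)
  have "successively (\<lambda>a b. {f a, f b} \<in> edges H) p"
    by (rule successively_mono[of "\<lambda>a b. {a, b} \<in> edges G"])
      (use assms p in \<open>auto simp: is_path_def graph_iso_def\<close>)
  moreover have "distinct (map f p)"
    using assms(2) inj_on_subset[OF inj p] by (simp add: distinct_map is_path_def)
  ultimately show ?thesis
    using assms(2) p im by (auto simp: is_path_def hd_map last_map successively_map)
qed

text \<open>The minimum for \<open>H\<close> ranges over at least the images of the paths of
  \<open>G\<close>. If \<open>G\<close> has no path, the right-hand side is \<infinity>.\<close>

lemma hop_dist_iso_le:
  assumes "graph_iso f G H"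
  shows "hop_dist H (f x) (f y) \<le> hop_dist G x y"
  unfolding hop_dist_def
proof (rule INF_mono)
  fix p assume "p \<in> {p. is_path G x p y}"
  then show "\<exists>q \<in> {q. is_path H (f x) q (f y)}. enat (length q - 1) \<le> enat (length p - 1)"
    by (intro bexI[of _ "map f p"]) (auto intro: is_path_map[OF assms])
qed

lemma hop_dist_iso:
  assumes "graph_iso f G H" and "x \<in> verts G" and "y \<in> verts G"
  shows "hop_dist H (f x) (f y) = hop_dist G x y"
proof (rule antisym[OF hop_dist_iso_le[OF assms(1)]])
  have "inj_on f (verts G)" using assms(1) by (simp add: graph_iso_def bij_betw_def)
  then show "hop_dist G x y \<le> hop_dist H (f x) (f y)"
    using hop_dist_iso_le[OF graph_iso_inv_into[OF assms(1)], of "f x" "f y"] assms(2,3) by simp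
qed

lemma nbhd_iso:
  assumes "graph_iso f G H" and "v \<in> verts G"
  shows "nbhd H (f v) = f ` nbhd G v"
proof -
  have "verts H = f ` verts G" using assms(1) by (simp add: graph_iso_def bij_betw_def)
  then show ?thesis using assms by (auto simp: nbhd_def graph_iso_def)
qed

text \<open>By injectivity of \<open>f\<close>, an edge of \<open>G\<close> avoids \<open>v\<close>
  exactly when its image avoids \<open>f v\<close>.\<close>

lemma graph_iso_delete_vertex:
  assumes "graph_iso f G H" and "v \<in> verts G"
  shows "graph_iso f (delete_vertex G v) (delete_vertex H (f v))"
proof -
  have bij: "bij_betw f (verts G) (verts H)" using assms by (simp add: graph_iso_def)
  then have "bij_betw f (verts G - {v}) (verts H - {f v})"
    using assms(2) by (intro bij_betw_DiffI) (auto simp: bij_betw_apply)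
  moreover have "f v = f u \<longleftrightarrow> v = u" if "u \<in> verts G" for u
    using bij that assms(2) by (auto simp: bij_betw_def inj_on_eq_iff)
  ultimately show ?thesis
    using assms by (auto simp: graph_iso_def delete_vertex_def)
qed

lemma simple_graph_delete_vertex:
  "simple_graph G \<Longrightarrow> simple_graph (delete_vertex G v)"
  by (auto simp: simple_graph_def delete_vertex_def)

text \<open>Edges have two elements, so \<open>v\<close> is not its own neighbour and every BFS
  start survives the deletion.\<close>

lemma nbhd_subset_delete_vertex:
  "simple_graph G \<Longrightarrow> nbhd G v \<subseteq> verts (delete_vertex G v)"
  by (auto simp: simple_graph_def nbhd_def delete_vertex_def)

lemma simple_graph_edgeD:
  "simple_graph G \<Longrightarrow> {u, t} \<in> edges G \<Longrightarrow> u \<in> verts G \<and> t \<in> verts G"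
  by (auto simp: simple_graph_def)

lemma parent_list_subset:
  assumes "simple_graph G" and "v \<in> verts G"
  shows "parent_list G v t h \<subseteq> verts G"
  using assms simple_graph_edgeD[OF assms(1)]
  by (auto simp: parent_list_def delete_vertex_def)

lemma parent_list_iso_subset:
  assumes iso: "graph_iso f G H" and G: "simple_graph G" and v: "v \<in> verts G" and t: "t \<in> verts G"
  shows "f ` parent_list G v t h \<subseteq> parent_list H (f v) (f t) h"
proof (cases "h \<le> 1")
  case True
  then have "h = 0 \<or> h = 1" by linarith
  \<comment> \<open>At hop 1 the list is \<open>{v}\<close> or empty according to adjacency of
    \<open>v\<close> and \<open>t\<close>, which \<open>f\<close> preserves; at hop 0 both lists are
    empty.\<close>
  then show ?thesis using nbhd_iso[OF iso v] by (auto simp: parent_list_def)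
next
  case False
  let ?G' = "delete_vertex G v" and ?H' = "delete_vertex H (f v)"
  have iso': "graph_iso f ?G' ?H'" by (rule graph_iso_delete_vertex[OF iso v])
  show ?thesis
  proof
    fix w assume "w \<in> f ` parent_list G v t h"
    then obtain u s where w: "w = f u" and e: "{u, t} \<in> edges ?G'" and s: "s \<in> nbhd G v"
      and d: "hop_dist ?G' s u + 2 = enat h"
      using False by (auto simp: parent_list_def)
    have ut: "u \<in> verts ?G'" "t \<in> verts ?G'"
      using simple_graph_edgeD[OF simple_graph_delete_vertex[OF G] e] by auto
    then have "{f u, f t} \<in> edges ?H'" using iso' e by (simp add: graph_iso_def)
    \<comment> \<open>The start \<open>s\<close> that witnesses \<open>u\<close> as a parent is
      carried to the start \<open>f s\<close>: both \<open>s\<close> and \<open>u\<close> lie in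
      \<open>G - v\<close>, where distances are invariant.\<close>
    moreover have "hop_dist ?H' (f s) (f u) + 2 = enat h"
      using hop_dist_iso[OF iso' subsetD[OF nbhd_subset_delete_vertex[OF G] s] ut(1)] d by simp
    moreover have "f s \<in> nbhd H (f v)" using nbhd_iso[OF iso v] s by simp
    ultimately show "w \<in> parent_list H (f v) (f t) h"
      using False w by (auto simp: parent_list_def)
  qed
qed

lemma parent_list_iso:
  assumes iso: "graph_iso f G H" and G: "simple_graph G" and H: "simple_graph H"
    and v: "v \<in> verts G" and t: "t \<in> verts G"
  shows "parent_list H (f v) (f t) h = f ` parent_list G v t h"
proof (rule antisym[OF _ parent_list_iso_subset[OF iso G v t]])
  let ?g = "inv_into (verts G) f"
  have inj: "inj_on f (verts G)" and im: "f ` verts G = verts H"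
    using iso by (auto simp: graph_iso_def bij_betw_def)
  have fv: "f v \<in> verts H" and ft: "f t \<in> verts H" using im v t by auto
  \<comment> \<open>The inclusion already proved, applied to the inverse isomorphism at
    \<open>f v\<close> and \<open>f t\<close>; taking images under \<open>f\<close> then gives the
    converse inclusion.\<close>
  have "?g ` parent_list H (f v) (f t) h \<subseteq> parent_list G v t h"
    using parent_list_iso_subset[OF graph_iso_inv_into[OF iso] H fv ft] inj v t by simp
  moreover have "f ` ?g ` parent_list H (f v) (f t) h = parent_list H (f v) (f t) h"
    using parent_list_subset[OF H fv] im by (intro image_inv_into_cancel) auto
  ultimately show "parent_list H (f v) (f t) h \<subseteq> f ` parent_list G v t h"
    by (metis image_mono)
qed

text \<open>Taking images under \<open>f\<close> matches the unordered pairs of the two sets and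
  keeps their distances. Sizes agree too, so the default \<kappa> is taken on both sides or on
  neither.\<close>

lemma AvPD_iso:
  assumes iso: "graph_iso f G H" and pl: "pl \<subseteq> verts G"
  shows "AvPD \<kappa> H (f ` pl) = AvPD \<kappa> G pl"
proof -
  let ?E = "{e. e \<subseteq> pl \<and> card e = 2}" and ?F = "{e. e \<subseteq> f ` pl \<and> card e = 2}"
  have inj: "inj_on f pl"
    using iso pl by (auto simp: graph_iso_def bij_betw_def intro: inj_on_subset)
  have card: "card (f ` e) = card e" if "e \<subseteq> pl" for e
    using card_image inj inj_on_subset that by blast
  have bij: "bij_betw ((`) f) ?E ?F"
    unfolding bij_betw_def
  proof
    show "inj_on ((`) f) ?E"
      by (rule inj_on_subset[OF inj_on_image_Pow[OF inj]]) auto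
    show "(`) f ` ?E = ?F"
      using card by (auto simp: subset_image_iff)
  qed
  have "pair_dist H (f ` e) = pair_dist G e" if "e \<in> ?E" for e
  proof -
    obtain x y where e: "e = {x, y}" using \<open>e \<in> ?E\<close> by (auto simp: card_2_iff)
    then have "x \<in> verts G" "y \<in> verts G" using that pl by auto
    then show ?thesis using hop_dist_iso[OF iso] e by simp
  qed
  then have "(\<Sum>e\<in>?F. real (the_enat (pair_dist H e))) = (\<Sum>e\<in>?E. real (the_enat (pair_dist G e)))"
    by (subst sum.reindex_bij_betw[OF bij, symmetric]) simp
  moreover have "card ?F = card ?E" using bij_betw_same_card[OF bij] by simp
  ultimately show ?thesis by (simp add: AvPD_def card)
qed

text \<open>The count \<open>c\<close> survives because \<open>f\<close> is injective on each parent
  list. The default triple also fits, since the image of the empty set is empty.\<close>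

lemma hop_parents_iso:
  assumes "graph_iso f G H" and "simple_graph G" and "simple_graph H"
    and "v \<in> verts G" and "t \<in> verts G"
  shows "hop_parents H (f v) (f t) = (\<lambda>(h, c, pl). (h, c, f ` pl)) ` hop_parents G v t"
proof -
  have "inj_on f (parent_list G v t h)" for h
    using assms(1) parent_list_subset[OF assms(2,4)]
    by (meson bij_betw_def graph_iso_def inj_on_subset)
  then have "card (f ` parent_list G v t h) = card (parent_list G v t h)" for h
    by (rule card_image)
  then show ?thesis
    by (auto simp: hop_parents_def Let_def parent_list_iso[OF assms] image_iff)
qed

lemma hop_parents_subset:
  assumes "simple_graph G" and "v \<in> verts G" and "(h, c, pl) \<in> hop_parents G v t"
  shows "pl \<subseteq> verts G"
  using assms(3) parent_list_subset[OF assms(1,2)]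
  by (auto simp: hop_parents_def Let_def split: if_splits)

lemma pair_sig_iso:
  assumes "graph_iso f G H" and "simple_graph G" and "simple_graph H"
    and "v \<in> verts G" and "t \<in> verts G"
  shows "pair_sig P \<kappa> H (f v) (f t) = pair_sig P \<kappa> G v t"
proof -
  have inj: "inj_on f (verts G)"
    using assms(1) by (simp add: graph_iso_def bij_betw_def)
  \<comment> \<open>The product runs over a set of triples, so reindexing it requires that no two
    triples be merged; sets of vertices of \<open>G\<close> are determined by their images under
    \<open>f\<close>.\<close>
  have "inj_on (\<lambda>(h, c, pl). (h, c, f ` pl)) (hop_parents G v t)"
  proof (rule inj_onI)
    fix x y
    assume xy: "x \<in> hop_parents G v t" "y \<in> hop_parents G v t"
      and eq: "(\<lambda>(h, c, pl). (h, c, f ` pl)) x = (\<lambda>(h, c, pl). (h, c, f ` pl)) y"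
    obtain h c pl where x: "x = (h, c, pl)" by (cases x)
    obtain h' c' pl' where y: "y = (h', c', pl')" by (cases y)
    have "pl \<subseteq> verts G" "pl' \<subseteq> verts G"
      using hop_parents_subset[OF assms(2,4)] xy x y by auto
    then show "x = y"
      using eq x y inj_on_image_eq_iff[OF inj] by simp
  qed
  then show ?thesis
    unfolding pair_sig_def hop_parents_iso[OF assms]
    by (subst prod.reindex)
      (auto intro!: prod.cong simp: AvPD_iso[OF assms(1) hop_parents_subset[OF assms(2,4)]])
qed

lemma image_mset_mset_set_bij_betw:
  assumes "bij_betw f A B" and "\<And>x. x \<in> A \<Longrightarrow> k (f x) = g x"
  shows "image_mset k (mset_set B) = image_mset g (mset_set A)"
proof -
  have "mset_set B = image_mset f (mset_set A)"
    using assms(1) by (auto simp: bij_betw_def image_mset_mset_set)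
  moreover have "image_mset (k \<circ> f) (mset_set A) = image_mset g (mset_set A)"
    \<comment> \<open>For infinite \<open>A\<close>, \<open>mset_set A\<close> is empty by
      convention and there is nothing to check.\<close>
    using assms(2) by (intro image_mset_cong) (cases "finite A"; simp)
  ultimately show ?thesis by (simp add: multiset.map_comp)
qed

text \<open>Sorting forgets which target produced which value, so it suffices that \<open>f\<close>
  matches the targets \<open>t\<close> and \<open>f t\<close> with equal values.\<close>

lemma signature_iso:
  assumes "graph_iso f G H" and "simple_graph G" and "simple_graph H" and "v \<in> verts G"
  shows "signature P \<kappa> H (f v) = signature P \<kappa> G v"
proof -
  have "bij_betw f (verts G) (verts H)" using assms(1) by (simp add: graph_iso_def)
  then show ?thesis
    unfolding signature_def
    by (subst image_mset_mset_set_bij_betw[where g = "pair_sig P \<kappa> G v"])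
      (auto intro: pair_sig_iso[OF assms])
qed

theorem corollary1:
  fixes P :: "nat \<Rightarrow> nat" and \<kappa> :: real
    and G1 :: "'a graph" and G2 :: "'b graph"
  assumes "inj P" and "\<And>h. prime (P h) \<and> P h \<ge> 3"
    and "simple_graph G1" and "simple_graph G2"
    and "isomorphic G1 G2"
  shows "certificates_equivalent P \<kappa> G1 G2 \<and> certificate P \<kappa> G1 = certificate P \<kappa> G2"
proof -
  obtain f where f: "graph_iso f G1 G2" using assms(5) by (auto simp: isomorphic_def)
  then have bij: "bij_betw f (verts G1) (verts G2)" by (simp add: graph_iso_def)
  have sig: "signature P \<kappa> G2 (f v) = signature P \<kappa> G1 v" if "v \<in> verts G1" for v
    by (rule signature_iso[OF f assms(3,4) that])
  have "certificates_equivalent P \<kappa> G1 G2"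
    unfolding certificates_equivalent_def using bij sig by (intro exI[of _ f]) simp
  moreover have "certificate P \<kappa> G2 = certificate P \<kappa> G1"
    unfolding certificate_def by (rule image_mset_mset_set_bij_betw[OF bij]) (rule sig)
  ultimately show ?thesis by simp
qed

end
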